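(* Let $0<p,q\le\infty$ and $s>0$. There exist constants $c_1,c_2>0$ such that for all $0<\lambda\le 1$ and all $f\in \mathbf{B}^s_{p,q}(\mathbb{R}^n)$ with $\operatorname{supp} f\subset B_\lambda$, $$c_1\,\lambda^{s-\frac np}\,\|f|\mathbf{B}^s_{p,q}(\mathbb{R}^n)\|\le \|f(\lambda\,\cdot)|\mathbf{B}^s_{p,q}(\mathbb{R}^n)\|\le c_2\,\lambda^{s-\frac np}\,\|f|\mathbf{B}^s_{p,q}(\mathbb{R}^n)\|,$$ i.e. the two sides are equivalent with constants of equivalence independent of $\lambda$ and $f$.
   Context: $B_R=\{x\in\mathbb{R}^n:|x|<R\}$ for $R>0$. For $h\in\mathbb{R}^n$, $r\in\mathbb{N}$, the iterated differences are $(\Delta_h^1f)(x)=f(x+h)-f(x)$ and $(\Delta_h^{r+1}f)(x)=\Delta_h^1(\Delta_h^rf)(x)$. For $f\in L_p(\mathbb{R}^n)$, $0<p\le\infty$, $t>0$, the modulus of smoothness is $\omega_r(f,t)_p=\sup_{|h|\le t}\|\Delta_h^rf|L_p(\mathbb{R}^n)\|$, where $\|\cdot|L_p\|$ is the usual $L_p$ (quasi-)norm. For $0<p,q\le\infty$, $s>0$ and $r\in\mathbb{N}$ with $r>s$, the Besov space $\mathbf{B}^s_{p,q}(\mathbb{R}^n)$ consists of all $f\in L_p(\mathbb{R}^n)$ such that $$\|f|\mathbf{B}^s_{p,q}(\mathbb{R}^n)\|=\|f|L_p(\mathbb{R}^n)\|+\Big(\int_0^1t^{-sq}\omega_r(f,t)_p^q\,\frac{dt}{t}\Big)^{1/q}$$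 is finite (with the supremum $\sup_{0<t<1}t^{-s}\omega_r(f,t)_\cdot$ in place of the integral if $q=\infty$). Different choices of $r>s$ give equivalent quasi-norms, and replacing $\int_0^1$ by $\int_0^\infty$ also gives an equivalent quasi-norm; $r$ is fixed and suppressed in the notation. The constants may depend on $n,s,p,q,r$. *)

theory Defs
  imports "HOL-Probability.Essential_Supremum"
begin

text \<open>
  The space \<open>\<real>\<^sup>n\<close> is an arbitrary type of class \<open>euclidean_space\<close>, with \<open>n = DIM('a)\<close>. Functions are
  complex-valued; norms are taken in \<open>[0,\<infinity>]\<close>, and the exponents \<open>p, q \<in> (0,\<infinity>]\<close> are of type \<open>ennreal\<close>.
\<close>

text \<open>Only used with an exponent \<open>a > 0\<close>, so that \<open>0\<^sup>a = 0\<close> and \<open>\<infinity>\<^sup>a = \<infinity>\<close>.\<close>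

definition ennpowr :: "ennreal \<Rightarrow> real \<Rightarrow> ennreal" where
  "ennpowr x a = (if x = \<infinity> then \<infinity> else ennreal (enn2real x powr a))"

definition Lp_norm :: "ennreal \<Rightarrow> ('a::euclidean_space \<Rightarrow> complex) \<Rightarrow> ennreal" where
  "Lp_norm p f =
    (if p = \<infinity> then esssup lebesgue (\<lambda>x. ennreal (norm (f x)))
     else ennpowr (\<integral>\<^sup>+ x. ennreal (norm (f x) powr enn2real p) \<partial>lebesgue) (1 / enn2real p))"

definition Lp_space :: "ennreal \<Rightarrow> ('a::euclidean_space \<Rightarrow> complex) set" where
  "Lp_space p = {f. f \<in> borel_measurable lebesgue \<and> Lp_norm p f < \<infinity>}"

definition fdiff :: "'a::euclidean_space \<Rightarrow> ('a \<Rightarrow> complex) \<Rightarrow> 'a \<Rightarrow> complex" where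
  "fdiff h f = (\<lambda>x. f (x + h) - f x)"

definition iterated_diff :: "nat \<Rightarrow> 'a::euclidean_space \<Rightarrow> ('a \<Rightarrow> complex) \<Rightarrow> 'a \<Rightarrow> complex" where
  "iterated_diff r h = fdiff h ^^ r"

definition modulus_of_smoothness ::
    "nat \<Rightarrow> ennreal \<Rightarrow> ('a::euclidean_space \<Rightarrow> complex) \<Rightarrow> real \<Rightarrow> ennreal" where
  "modulus_of_smoothness r p f t = (SUP h\<in>{h. norm h \<le> t}. Lp_norm p (iterated_diff r h f))"

definition besov_norm ::
    "nat \<Rightarrow> real \<Rightarrow> ennreal \<Rightarrow> ennreal \<Rightarrow> ('a::euclidean_space \<Rightarrow> complex) \<Rightarrow> ennreal" where
  "besov_norm r s p q f = Lp_norm p f +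
    (if q = \<infinity> then SUP t\<in>{0<..<1}. ennreal (t powr (- s)) * modulus_of_smoothness r p f t
     else ennpowr
       (\<integral>\<^sup>+t\<in>{0<..<1}. (ennreal (t powr (- s * enn2real q)) *
          ennpowr (modulus_of_smoothness r p f t) (enn2real q) / ennreal t) \<partial>lborel)
       (1 / enn2real q))"

definition besov_space ::
    "nat \<Rightarrow> real \<Rightarrow> ennreal \<Rightarrow> ennreal \<Rightarrow> ('a::euclidean_space \<Rightarrow> complex) set" where
  "besov_space r s p q = {f. f \<in> Lp_space p \<and> besov_norm r s p q f < \<infinity>}"

text \<open>
  Elements of \<open>L\<^sub>p\<close> are determined only up to null sets, so the support is the essential one:
  the complement of the largest open set on which \<open>f\<close> vanishes almost everywhere.
\<close>

definition ess_support :: "('a::euclidean_space \<Rightarrow> complex) \<Rightarrow> 'a set" where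
  "ess_support f = - \<Union> {U. open U \<and> (AE x in lebesgue. x \<in> U \<longrightarrow> f x = 0)}"

end

theory Submission
  imports Defs
begin

text \<open>
  Write \<open>n = DIM('a)\<close>, \<open>e = n / p\<close>, \<open>F = \<parallel>f\<parallel>\<^sub>p\<close>, \<open>\<omega> = \<omega>\<^sub>r(f, \<cdot>)\<^sub>p\<close>, and let \<open>N(A)\<close> be the \<open>L\<^sub>q(A, dt/t)\<close> norm
  of \<open>t\<^sup>-\<^sup>s \<omega>(t)\<close> on a set \<open>A\<close> of positive reals. Then \<open>\<parallel>f\<parallel> = F + N(0,1)\<close>, and a change of
  variables, first in \<open>x\<close> and then in \<open>t\<close>, gives the identity \<open>besov_norm_dilation\<close>:
  \<open>\<parallel>f(l \<cdot>)\<parallel> = l powr (s - e) \<cdot> (l powr (- s) \<cdot> F + N(0,l))\<close>. It remains to show that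
  \<open>l powr (- s) \<cdot> F + N(0,l)\<close> and \<open>F + N(0,1)\<close> are comparable, uniformly in \<open>l \<le> 1\<close>.

  For the upper bound, \<open>N(0,l) \<le> N(0,1)\<close>, and \<open>l powr (- s) \<cdot> F\<close> is controlled because the support
  of \<open>f\<close> lies in a ball of radius \<open>l\<close>: a step \<open>h\<close> with \<open>|h| = 2l\<close> moves the ball off itself, so that
  \<open>|\<Delta>\<^sub>h\<^sup>r f| = |f|\<close> on the ball and \<open>\<omega>(t) \<ge> F\<close> for \<open>t \<ge> 2l\<close>. If \<open>4l \<le> 1\<close>, the interval \<open>[2l,4l)\<close> alone
  contributes a multiple of \<open>l powr (- s) \<cdot> F\<close> to \<open>N(0,1)\<close>; otherwise \<open>l powr (- s)\<close> is bounded.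
  This is \<open>Lp_norm_le_besov_norm_small_support\<close>.

  For the lower bound, \<open>F \<le> l powr (- s) \<cdot> F\<close>, and \<open>N(0,1)\<close> is at most a multiple of
  \<open>N(0,l) + N[l,1)\<close>. Since \<open>\<omega> \<le> C \<cdot> F\<close> everywhere, the tail \<open>N[l,1)\<close> is at most a multiple of
  \<open>l powr (- s) \<cdot> F\<close>; this is \<open>weighted_Lq_norm_modulus_tail_le\<close>.

  For \<open>p < 1\<close> or \<open>q < 1\<close> the norms are only quasi-norms, which costs constant factors
  \<open>2 powr (1 / p)\<close> and \<open>2 powr (1 / q)\<close>. As \<open>enn2real \<infinity> = 0\<close> and \<open>1 / 0 = 0\<close>, these formulas yield \<open>1\<close>
  for the exponent \<open>\<infinity>\<close>, so that one formula covers all exponents.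
\<close>

section \<open>Powers of extended nonnegative reals\<close>

lemma enn2real_pos: "0 < q \<Longrightarrow> q \<noteq> \<infinity> \<Longrightarrow> 0 < enn2real q"
  by (simp add: enn2real_positive_iff top.not_eq_extremum)

lemma ennpowr_ennreal: "0 \<le> x \<Longrightarrow> ennpowr (ennreal x) a = ennreal (x powr a)"
  by (simp add: ennpowr_def)

lemma ennpowr_mono: "0 \<le> a \<Longrightarrow> x \<le> y \<Longrightarrow> ennpowr x a \<le> ennpowr y a"
  by (cases x; cases y) (auto simp: ennpowr_def top_unique intro!: powr_mono2)

lemma ennpowr_cmult:
  assumes "0 \<le> k" "0 < a"
  shows "ennpowr (ennreal k * x) a = ennreal (k powr a) * ennpowr x a"
proof (cases x)
  case (real y)
  then show ?thesis
    using assms by (simp add: ennpowr_ennreal powr_mult flip: ennreal_mult)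
next
  case top
  then show ?thesis
    using assms by (cases "k = 0") (auto simp: ennpowr_def ennreal_mult_top)
qed

text \<open>
  The substitute for subadditivity, which fails for \<open>a > 1\<close>: a sum is at most twice the larger
  summand.
\<close>

lemma ennpowr_add_le:
  assumes "0 < a"
  shows "ennpowr (x + y) a \<le> ennreal (2 powr a) * (ennpowr x a + ennpowr y a)"
proof -
  have "x + y \<le> ennreal 2 * max x y"
    using add_mono[of x "max x y" y "max x y"] by (simp add: mult_2)
  then have "ennpowr (x + y) a \<le> ennreal (2 powr a) * ennpowr (max x y) a"
    using ennpowr_mono[of a "x + y" "ennreal 2 * max x y"] assms by (simp only: ennpowr_cmult)
  also have "\<dots> \<le> ennreal (2 powr a) * (ennpowr x a + ennpowr y a)"
    by (intro mult_left_mono) (auto simp: max_def)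
  finally show ?thesis .
qed

lemma borel_measurable_ennpowr [measurable]:
  assumes [measurable]: "w \<in> borel_measurable M"
  shows "(\<lambda>t. ennpowr (w t) a) \<in> borel_measurable M"
  unfolding ennpowr_def by measurable

lemma borel_measurable_mono_ennreal:
  fixes w :: "real \<Rightarrow> ennreal"
  assumes "mono w"
  shows "w \<in> borel_measurable borel"
proof (rule borel_measurableI_greater)
  fix y
  have "is_interval {t. y < w t}"
    unfolding is_interval_1 using monoD[OF assms] by (force intro: less_le_trans)
  then show "{t \<in> space borel. y < w t} \<in> sets borel"
    using real_interval_borel_measurable by simp
qed

section \<open>The quasi-norm of \<open>L\<^sub>p\<close>\<close>

lemma
  fixes c :: real and a :: "'a::euclidean_space"
  assumes "0 < c"
  shows measurable_lebesgue_affine: "(\<lambda>x. a + c *\<^sub>R x) \<in> lebesgue \<rightarrow>\<^sub>M lebesgue"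
    and lebesgue_eq_density_affine:
      "lebesgue = density (distr lebesgue lebesgue (\<lambda>x. a + c *\<^sub>R x)) (\<lambda>_. ennreal (c ^ DIM('a)))"
proof -
  have T: "(\<lambda>x. a + (\<Sum>j\<in>Basis. (c * (x \<bullet> j)) *\<^sub>R j)) = (\<lambda>x. a + c *\<^sub>R x)"
    by (simp add: euclidean_representation flip: scaleR_scaleR scaleR_sum_right)
  show "(\<lambda>x. a + c *\<^sub>R x) \<in> lebesgue \<rightarrow>\<^sub>M lebesgue"
    using lebesgue_affine_measurable[of "\<lambda>_. c" a] assms by (simp add: T)
  show "lebesgue = density (distr lebesgue lebesgue (\<lambda>x. a + c *\<^sub>R x)) (\<lambda>_. ennreal (c ^ DIM('a)))"
    using lebesgue_affine_euclidean[of "\<lambda>_. c" a] assms by (simp add: T)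
qed

lemma measurable_compose_affine:
  fixes f :: "'a::euclidean_space \<Rightarrow> 'b"
  assumes "f \<in> lebesgue \<rightarrow>\<^sub>M N" "0 < c"
  shows "(\<lambda>x. f (a + c *\<^sub>R x)) \<in> lebesgue \<rightarrow>\<^sub>M N"
  using measurable_compose[OF measurable_lebesgue_affine[OF assms(2)] assms(1)] .

lemma nn_integral_lebesgue_affine:
  fixes f :: "'a::euclidean_space \<Rightarrow> ennreal"
  assumes f: "f \<in> borel_measurable lebesgue" and c: "0 < c"
  shows "(\<integral>\<^sup>+x. f x \<partial>lebesgue) = ennreal (c ^ DIM('a)) * (\<integral>\<^sup>+x. f (a + c *\<^sub>R x) \<partial>lebesgue)"
proof -
  let ?D = "distr lebesgue lebesgue (\<lambda>x. a + c *\<^sub>R x)"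
  have "(\<integral>\<^sup>+x. f x \<partial>lebesgue) = (\<integral>\<^sup>+x. f x \<partial>density ?D (\<lambda>_. ennreal (c ^ DIM('a))))"
    by (subst lebesgue_eq_density_affine[OF c, of a]) simp
  also have "\<dots> = ennreal (c ^ DIM('a)) * (\<integral>\<^sup>+x. f x \<partial>?D)"
    using f by (subst nn_integral_density) (auto intro!: nn_integral_cmult simp: measurable_distr_eq1)
  also have "(\<integral>\<^sup>+x. f x \<partial>?D) = (\<integral>\<^sup>+x. f (a + c *\<^sub>R x) \<partial>lebesgue)"
    using f by (intro nn_integral_distr measurable_lebesgue_affine[OF c]) (simp add: measurable_distr_eq1)
  finally show ?thesis .
qed

text \<open>
  The change of variables formula, applied to the indicator of a null set that contains all
  exceptional points.
\<close>

lemma AE_lebesgue_affine: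
  fixes a :: "'a::euclidean_space"
  assumes P: "AE x in lebesgue. P x" and c: "0 < c"
  shows "AE x in lebesgue. P (a + c *\<^sub>R x)"
proof -
  obtain N where N: "N \<in> null_sets lebesgue" "{x. \<not> P x} \<subseteq> N"
    using P by (auto simp: eventually_ae_filter)
  have "0 = ennreal (c ^ DIM('a)) * (\<integral>\<^sup>+x. indicator N (a + c *\<^sub>R x) \<partial>lebesgue)"
    using N(1) c by (subst nn_integral_lebesgue_affine[symmetric]) (auto simp: null_setsD1 null_setsD2)
  then have "(\<integral>\<^sup>+x. indicator N (a + c *\<^sub>R x) \<partial>lebesgue) = (0::ennreal)"
    using c by auto
  moreover have "(\<lambda>x. indicator N (a + c *\<^sub>R x) :: ennreal) \<in> borel_measurable lebesgue"
    using N(1) c by (intro measurable_compose_affine) auto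
  ultimately have "AE x in lebesgue. indicator N (a + c *\<^sub>R x) = (0::ennreal)"
    by (simp add: nn_integral_0_iff_AE)
  then show ?thesis
    by (rule eventually_mono) (use N(2) in \<open>auto split: split_indicator_asm\<close>)
qed

lemma Lp_norm_mono_AE:
  assumes f: "f \<in> borel_measurable lebesgue"
    and le: "AE x in lebesgue. norm (f x) \<le> norm (g x)"
  shows "Lp_norm p f \<le> Lp_norm p g"
proof (cases "p = \<infinity>")
  case True
  show ?thesis
    unfolding Lp_norm_def if_P[OF True]
    using f le by (intro esssup_AE_mono) (auto elim!: eventually_mono intro: ennreal_leI)
next
  case False
  have "(\<integral>\<^sup>+ x. ennreal (norm (f x) powr enn2real p) \<partial>lebesgue)
      \<le> (\<integral>\<^sup>+ x. ennreal (norm (g x) powr enn2real p) \<partial>lebesgue)"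
    using le by (intro nn_integral_mono_AE) (auto elim!: eventually_mono intro!: ennreal_leI powr_mono2)
  then show ?thesis
    using False by (auto simp: Lp_norm_def intro!: ennpowr_mono)
qed

lemma Lp_norm_diff_le:
  assumes [measurable]: "f \<in> borel_measurable lebesgue" "g \<in> borel_measurable lebesgue" and p: "0 < p"
  shows "Lp_norm p (\<lambda>x. f x - g x)
    \<le> ennreal (2 * 2 powr (1 / enn2real p)) * (Lp_norm p f + Lp_norm p g)"
proof (cases "p = \<infinity>")
  case True
  let ?F = "Lp_norm p f" and ?G = "Lp_norm p g"
  have "AE x in lebesgue. ennreal (norm (f x)) \<le> ?F" "AE x in lebesgue. ennreal (norm (g x)) \<le> ?G"
    using esssup_AE[of "\<lambda>x. ennreal (norm (f x))" lebesgue]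
      esssup_AE[of "\<lambda>x. ennreal (norm (g x))" lebesgue] True by (auto simp: Lp_norm_def)
  then have "AE x in lebesgue. ennreal (norm (f x - g x)) \<le> ?F + ?G"
  proof eventually_elim
    case (elim x)
    have "ennreal (norm (f x - g x)) \<le> ennreal (norm (f x)) + ennreal (norm (g x))"
      by (simp add: ennreal_leI norm_triangle_ineq4 flip: ennreal_plus)
    then show ?case
      using add_mono[OF elim] by (rule order_trans)
  qed
  then have "Lp_norm p (\<lambda>x. f x - g x) \<le> ?F + ?G"
    unfolding Lp_norm_def[of p "\<lambda>x. f x - g x"] if_P[OF True] by (intro esssup_I) auto
  also have "\<dots> \<le> ennreal 2 * (?F + ?G)"
    by (simp add: mult_2)
  finally show ?thesis
    using True by simp
next
  case False
  define P where "P = enn2real p"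
  have P: "0 < P"
    using p False by (simp add: P_def enn2real_pos)
  let ?I = "\<lambda>f. \<integral>\<^sup>+ x. ennreal (norm (f x) powr P) \<partial>lebesgue"
  have *: "norm (u - v) powr P \<le> 2 powr P * (norm u powr P + norm v powr P)" for u v :: complex
  proof -
    have "norm (u - v) powr P \<le> (2 * max (norm u) (norm v)) powr P"
      using P norm_triangle_ineq4[of u v] by (intro powr_mono2) auto
    also have "\<dots> = 2 powr P * max (norm u) (norm v) powr P"
      by (simp add: powr_mult)
    also have "\<dots> \<le> 2 powr P * (norm u powr P + norm v powr P)"
      by (intro mult_left_mono) (auto simp: max_def)
    finally show ?thesis .
  qed
  have "?I (\<lambda>x. f x - g x)
      \<le> (\<integral>\<^sup>+ x. ennreal (2 powr P) * (ennreal (norm (f x) powr P) + ennreal (norm (g x) powr P)) \<partial>lebesgue)"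
    by (intro nn_integral_mono) (simp add: ennreal_leI * flip: ennreal_plus ennreal_mult)
  also have "\<dots> = ennreal (2 powr P) * (?I f + ?I g)"
    by (simp add: nn_integral_cmult nn_integral_add)
  finally have "ennpowr (?I (\<lambda>x. f x - g x)) (1 / P) \<le> ennpowr (ennreal (2 powr P) * (?I f + ?I g)) (1 / P)"
    using P by (intro ennpowr_mono) auto
  also have "\<dots> = ennreal 2 * ennpowr (?I f + ?I g) (1 / P)"
    using P by (simp add: ennpowr_cmult powr_powr)
  also have "\<dots> \<le> ennreal 2 * (ennreal (2 powr (1 / P)) * (ennpowr (?I f) (1 / P) + ennpowr (?I g) (1 / P)))"
    using P by (intro mult_left_mono ennpowr_add_le) auto
  finally show ?thesis
    using False by (simp add: Lp_norm_def P_def ennreal_mult mult.assoc)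
qed

lemma enn2real_of_nat_divide:
  "enn2real (of_nat n / p) = (if p = \<infinity> then 0 else real n / enn2real p)"
proof (cases p)
  case (real P)
  show ?thesis
  proof (cases "P = 0")
    case True
    then show ?thesis
      using real by (cases "n = 0") auto
  next
    case False
    then show ?thesis
      using real by (simp add: divide_ennreal ennreal_of_nat_eq_real_of_nat)
  qed
qed auto

lemma Lp_norm_affine:
  fixes f :: "'a::euclidean_space \<Rightarrow> complex"
  assumes f[measurable]: "f \<in> borel_measurable lebesgue" and c: "0 < c" and p: "0 < p"
  shows "Lp_norm p (\<lambda>x. f (a + c *\<^sub>R x))
    = ennreal (c powr (- enn2real (of_nat DIM('a) / p))) * Lp_norm p f"
proof (cases "p = \<infinity>")
  case True
  have le: "Lp_norm p (\<lambda>x. f (a + c *\<^sub>R x)) \<le> Lp_norm p f"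
    if [measurable]: "f \<in> borel_measurable lebesgue" and c: "0 < c"
    for f :: "'a \<Rightarrow> complex" and a and c :: real
  proof -
    have "(\<lambda>x. f (a + c *\<^sub>R x)) \<in> borel_measurable lebesgue"
      using that by (rule measurable_compose_affine)
    moreover have "AE x in lebesgue. ennreal (norm (f (a + c *\<^sub>R x))) \<le> Lp_norm p f"
      using AE_lebesgue_affine[OF esssup_AE[of "\<lambda>x. ennreal (norm (f x))" lebesgue] c, of a] True
      by (simp add: Lp_norm_def)
    ultimately show ?thesis
      unfolding Lp_norm_def[of p "\<lambda>x. f (a + c *\<^sub>R x)"] if_P[OF True] by (intro esssup_I) auto
  qed
  \<comment> \<open>The reverse inequality is \<open>le\<close> for the inverse affine map.\<close>
  have "Lp_norm p f = Lp_norm p (\<lambda>x. f (a + c *\<^sub>R (- (1 / c) *\<^sub>R a + (1 / c) *\<^sub>R x)))"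
    using c by (simp add: scaleR_diff_right)
  also have "\<dots> \<le> Lp_norm p (\<lambda>x. f (a + c *\<^sub>R x))"
    using le[of "\<lambda>x. f (a + c *\<^sub>R x)" "1 / c" "- (1 / c) *\<^sub>R a"] c
      measurable_compose_affine[OF f c, of a] by simp
  finally show ?thesis
    using le[OF f c, of a] True c by (simp add: enn2real_of_nat_divide)
next
  case False
  define P where "P = enn2real p"
  have P: "0 < P"
    using p False by (simp add: P_def enn2real_pos)
  let ?n = "real DIM('a)"
  let ?I = "\<integral>\<^sup>+ x. ennreal (norm (f x) powr P) \<partial>lebesgue"
  let ?J = "\<integral>\<^sup>+ x. ennreal (norm (f (a + c *\<^sub>R x)) powr P) \<partial>lebesgue"
  have "?I = ennreal (c powr ?n) * ?J"
    using c by (subst nn_integral_lebesgue_affine[OF _ c, of _ a]) (auto simp: powr_realpow)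
  then have "ennreal (c powr (- ?n)) * ?I = ennreal (c powr (- ?n) * c powr ?n) * ?J"
    by (simp add: ennreal_mult mult.assoc)
  also have "c powr (- ?n) * c powr ?n = 1"
    using c by (simp flip: powr_add)
  finally have "?J = ennreal (c powr (- ?n)) * ?I"
    by simp
  then have "ennpowr ?J (1 / P) = ennreal (c powr (- (?n / P))) * ennpowr ?I (1 / P)"
    using P by (simp add: ennpowr_cmult powr_powr)
  then show ?thesis
    using False by (simp add: Lp_norm_def P_def enn2real_of_nat_divide)
qed

section \<open>Iterated differences\<close>

lemma iterated_diff_0 [simp]: "iterated_diff 0 h f = f"
  by (simp add: iterated_diff_def)

lemma iterated_diff_Suc: "iterated_diff (Suc r) h f = (\<lambda>x. iterated_diff r h f (x + h) - iterated_diff r h f x)"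
  by (simp add: iterated_diff_def fdiff_def)

lemma borel_measurable_iterated_diff:
  assumes "f \<in> borel_measurable lebesgue"
  shows "iterated_diff r h f \<in> borel_measurable lebesgue"
proof (induction r)
  case (Suc r)
  have "(\<lambda>x. iterated_diff r h f (x + h)) \<in> borel_measurable lebesgue"
    using measurable_compose_affine[OF Suc, of 1 h] by (simp add: add.commute)
  with Suc show ?case
    by (simp add: iterated_diff_Suc)
qed (use assms in simp)

lemma iterated_diff_scale:
  "iterated_diff r h (\<lambda>x. f (l *\<^sub>R x)) = (\<lambda>x. iterated_diff r (l *\<^sub>R h) f (l *\<^sub>R x))"
  by (induction r) (auto simp: iterated_diff_Suc scaleR_add_right)

lemma Lp_norm_iterated_diff_le:
  assumes f: "f \<in> borel_measurable lebesgue" and p: "0 < p"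
  shows "Lp_norm p (iterated_diff r h f) \<le> ennreal ((4 * 2 powr (1 / enn2real p)) ^ r) * Lp_norm p f"
proof (induction r)
  case (Suc r)
  let ?K = "2 powr (1 / enn2real p)" and ?D = "iterated_diff r h f"
  have D: "?D \<in> borel_measurable lebesgue"
    using f by (rule borel_measurable_iterated_diff)
  have D': "(\<lambda>x. ?D (x + h)) \<in> borel_measurable lebesgue"
    using measurable_compose_affine[OF D, of 1 h] by (simp add: add.commute)
  have "Lp_norm p (\<lambda>x. ?D (x + h)) = Lp_norm p ?D"
    using Lp_norm_affine[OF D _ p, of 1 h] by (simp add: add.commute)
  then have "Lp_norm p (iterated_diff (Suc r) h f) \<le> ennreal (2 * ?K) * (Lp_norm p ?D + Lp_norm p ?D)"
    using Lp_norm_diff_le[OF D' D p] by (simp add: iterated_diff_Suc)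
  also have "\<dots> = ennreal (2 * ?K) * (ennreal 2 * Lp_norm p ?D)"
    by (subst mult_2[symmetric]) simp
  also have "\<dots> = ennreal (2 * ?K * 2) * Lp_norm p ?D"
    by (subst ennreal_mult) (auto simp: mult.assoc)
  also have "2 * ?K * 2 = 4 * ?K"
    by simp
  also have "ennreal (4 * ?K) * Lp_norm p ?D \<le> ennreal (4 * ?K) * (ennreal ((4 * ?K) ^ r) * Lp_norm p f)"
    by (intro mult_left_mono Suc) auto
  finally show ?case
    by (simp add: ennreal_mult mult.assoc)
qed simp

text \<open>
  \<open>\<Delta>\<^sub>h\<^sup>r f(x)\<close> is a combination of the values \<open>f(x + j h)\<close> with \<open>0 \<le> j \<le> r\<close>, in which \<open>f(x)\<close> has the
  coefficient \<open>(- 1)\<^sup>r\<close>. The induction avoids the other coefficients by carrying along that all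
  differences vanish at the later points \<open>x + j h\<close>.
\<close>

lemma iterated_diff_eq_if_zero_ahead:
  assumes "\<And>j. 1 \<le> j \<Longrightarrow> f (x + real j *\<^sub>R h) = 0"
  shows "iterated_diff r h f x = (- 1) ^ r * f x"
proof -
  have "(\<forall>j\<ge>1. iterated_diff r h f (x + real j *\<^sub>R h) = 0) \<and> iterated_diff r h f x = (- 1) ^ r * f x"
  proof (induction r)
    case (Suc r)
    have shift: "x + real j *\<^sub>R h + h = x + real (Suc j) *\<^sub>R h" for j
      by (simp add: algebra_simps)
    have "iterated_diff r h f (x + h) = 0"
      using Suc shift[of 0] by (metis One_nat_def add.right_neutral le_refl of_nat_0 scaleR_zero_left)
    then show ?case
      using Suc by (auto simp: iterated_diff_Suc shift simp del: of_nat_Suc)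
  qed (use assms in auto)
  then show ?thesis by blast
qed

text \<open>
  The complement of the essential support is a union of possibly uncountably many open sets on
  which \<open>f\<close> vanishes almost everywhere; by Lindelof's theorem countably many of them suffice.
\<close>

lemma AE_zero_outside_ess_support:
  assumes "ess_support f \<subseteq> S"
  shows "AE x in lebesgue. x \<notin> S \<longrightarrow> f x = 0"
proof -
  define \<U> where "\<U> = {U. open U \<and> (AE x in lebesgue. x \<in> U \<longrightarrow> f x = 0)}"
  obtain \<V> where \<V>: "\<V> \<subseteq> \<U>" "countable \<V>" "\<Union>\<V> = \<Union>\<U>"
    using Lindelof[of \<U>] by (auto simp: \<U>_def)
  have "AE x in lebesgue. \<forall>V\<in>\<V>. x \<in> V \<longrightarrow> f x = 0"
    using \<V> by (subst AE_ball_countable) (auto simp: \<U>_def)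
  then show ?thesis
    by (rule eventually_mono) (use assms \<V>(3) in \<open>auto simp: ess_support_def \<U>_def\<close>)
qed

text \<open>
  A step of length at least the diameter of the ball carries every point of the ball, and all its
  further translates, out of the ball. Hence the values of \<open>f\<close> on the ball reappear, up to sign, in
  its differences.
\<close>

lemma Lp_norm_le_iterated_diff:
  fixes f :: "'a::euclidean_space \<Rightarrow> complex"
  assumes f: "f \<in> borel_measurable lebesgue"
    and zero: "AE x in lebesgue. x \<notin> ball 0 l \<longrightarrow> f x = 0" and h: "2 * l \<le> norm h"
  shows "Lp_norm p f \<le> Lp_norm p (iterated_diff r h f)"
proof (rule Lp_norm_mono_AE[OF f])
  have "AE x in lebesgue. x + real j *\<^sub>R h \<notin> ball 0 l \<longrightarrow> f (x + real j *\<^sub>R h) = 0" for j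
    using AE_lebesgue_affine[OF zero, of 1 "real j *\<^sub>R h"] by (simp add: add.commute)
  then have "AE x in lebesgue. \<forall>j. x + real j *\<^sub>R h \<notin> ball 0 l \<longrightarrow> f (x + real j *\<^sub>R h) = 0"
    by (simp add: AE_all_countable)
  with zero show "AE x in lebesgue. norm (f x) \<le> norm (iterated_diff r h f x)"
  proof eventually_elim
    case (elim x)
    show ?case
    proof (cases "x \<in> ball 0 l")
      case True
      have "f (x + real j *\<^sub>R h) = 0" if "1 \<le> j" for j
      proof -
        have "2 * l \<le> norm (real j *\<^sub>R h)"
          using h that mult_right_mono[of 1 "real j" "norm h"] by simp
        then have "l \<le> norm (x + real j *\<^sub>R h)"
          using True norm_triangle_ineq4[of "x + real j *\<^sub>R h" x] by simp
        then show ?thesis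
          using elim(2) by simp
      qed
      then show ?thesis
        by (simp add: iterated_diff_eq_if_zero_ahead norm_mult norm_power)
    qed (use elim in simp)
  qed
qed

section \<open>The modulus of smoothness\<close>

lemma mono_modulus_of_smoothness: "mono (modulus_of_smoothness r p f)"
  unfolding modulus_of_smoothness_def by (intro monoI SUP_subset_mono) auto

lemma modulus_of_smoothness_le:
  assumes "f \<in> borel_measurable lebesgue" "0 < p"
  shows "modulus_of_smoothness r p f t \<le> ennreal ((4 * 2 powr (1 / enn2real p)) ^ r) * Lp_norm p f"
  unfolding modulus_of_smoothness_def by (intro SUP_least Lp_norm_iterated_diff_le assms)

lemma modulus_of_smoothness_scale:
  fixes f :: "'a::euclidean_space \<Rightarrow> complex"
  assumes f: "f \<in> borel_measurable lebesgue" and p: "0 < p" and l: "0 < l"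
  shows "modulus_of_smoothness r p (\<lambda>x. f (l *\<^sub>R x)) t
    = ennreal (l powr (- enn2real (of_nat DIM('a) / p))) * modulus_of_smoothness r p f (l * t)"
proof -
  have "(\<lambda>h. l *\<^sub>R h) ` {h::'a. norm h \<le> t} = {h. norm h \<le> l * t}"
  proof (intro equalityI subsetI)
    fix h :: 'a
    assume "h \<in> {h. norm h \<le> l * t}"
    then show "h \<in> (\<lambda>h. l *\<^sub>R h) ` {h. norm h \<le> t}"
      using l by (intro image_eqI[of _ _ "(1 / l) *\<^sub>R h"]) (auto simp: field_simps)
  qed (use l in auto)
  then have "modulus_of_smoothness r p f (l * t)
      = (SUP h\<in>(\<lambda>h. l *\<^sub>R h) ` {h. norm h \<le> t}. Lp_norm p (iterated_diff r h f))"
    by (simp only: modulus_of_smoothness_def)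
  then have "modulus_of_smoothness r p f (l * t)
      = (SUP h\<in>{h. norm h \<le> t}. Lp_norm p (iterated_diff r (l *\<^sub>R h) f))"
    by (simp only: image_image)
  moreover have "Lp_norm p (iterated_diff r h (\<lambda>x. f (l *\<^sub>R x)))
      = ennreal (l powr (- enn2real (of_nat DIM('a) / p))) * Lp_norm p (iterated_diff r (l *\<^sub>R h) f)" for h
    using Lp_norm_affine[OF borel_measurable_iterated_diff[OF f] l p, where a = 0] by (simp add: iterated_diff_scale)
  ultimately show ?thesis
    by (simp add: modulus_of_smoothness_def SUP_mult_left_ennreal)
qed

lemma Lp_norm_le_modulus_of_smoothness:
  fixes f :: "'a::euclidean_space \<Rightarrow> complex"
  assumes "f \<in> borel_measurable lebesgue" "AE x in lebesgue. x \<notin> ball 0 l \<longrightarrow> f x = 0"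
    and "0 < l" "2 * l \<le> t"
  shows "Lp_norm p f \<le> modulus_of_smoothness r p f t"
proof -
  obtain h :: 'a where h: "norm h = 2 * l"
    using vector_choose_size[of "2 * l"] assms(3) by auto
  have "Lp_norm p f \<le> Lp_norm p (iterated_diff r h f)"
    using assms h by (intro Lp_norm_le_iterated_diff) auto
  also have "\<dots> \<le> modulus_of_smoothness r p f t"
    unfolding modulus_of_smoothness_def using h assms(4) by (intro SUP_upper) auto
  finally show ?thesis .
qed

section \<open>Weighted \<open>L\<^sub>q\<close> norms on the half-line\<close>

text \<open>
  The second summand of the Besov norm, for an arbitrary function in place of the modulus of
  smoothness and an arbitrary set in place of the unit interval, so that the interval can be
  rescaled and split.
\<close>

definition weighted_Lq_norm :: "real \<Rightarrow> ennreal \<Rightarrow> real set \<Rightarrow> (real \<Rightarrow> ennreal) \<Rightarrow> ennreal" where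
  "weighted_Lq_norm s q A w =
    (if q = \<infinity> then SUP t\<in>A. ennreal (t powr (- s)) * w t
     else ennpowr
       (\<integral>\<^sup>+t\<in>A. (ennreal (t powr (- s * enn2real q)) * ennpowr (w t) (enn2real q) / ennreal t) \<partial>lborel)
       (1 / enn2real q))"

lemma besov_norm_eq:
  "besov_norm r s p q f = Lp_norm p f + weighted_Lq_norm s q {0<..<1} (modulus_of_smoothness r p f)"
  by (simp add: besov_norm_def weighted_Lq_norm_def)

lemma weighted_Lq_norm_mono:
  assumes "A \<subseteq> B" "\<And>t. t \<in> A \<Longrightarrow> w t \<le> v t"
  shows "weighted_Lq_norm s q A w \<le> weighted_Lq_norm s q B v"
proof (cases "q = \<infinity>")
  case True
  then show ?thesis
    using assms by (auto simp: weighted_Lq_norm_def intro!: SUP_mono' SUP_subset_mono mult_left_mono)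
next
  case False
  then show ?thesis
    using assms
    by (auto simp: weighted_Lq_norm_def divide_ennreal_def split: split_indicator
        intro!: ennpowr_mono nn_integral_mono mult_right_mono mult_left_mono)
qed

lemma weighted_Lq_norm_cmult:
  assumes [measurable]: "w \<in> borel_measurable borel" "A \<in> sets borel" and k: "0 \<le> k" and q: "0 < q"
  shows "weighted_Lq_norm s q A (\<lambda>t. ennreal k * w t) = ennreal k * weighted_Lq_norm s q A w"
proof (cases "q = \<infinity>")
  case True
  then show ?thesis
    by (simp add: weighted_Lq_norm_def SUP_mult_left_ennreal mult.left_commute)
next
  case False
  define Q where "Q = enn2real q"
  have Q: "0 < Q"
    using q False by (simp add: Q_def enn2real_pos)
  let ?I = "\<lambda>w. \<integral>\<^sup>+t\<in>A. (ennreal (t powr (- s * Q)) * ennpowr (w t) Q / ennreal t) \<partial>lborel"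
  have "?I (\<lambda>t. ennreal k * w t)
      = (\<integral>\<^sup>+t. ennreal (k powr Q) *
          (ennreal (t powr (- s * Q)) * ennpowr (w t) Q / ennreal t * indicator A t) \<partial>lborel)"
    using Q k by (intro nn_integral_cong) (simp add: ennpowr_cmult divide_ennreal_def mult_ac)
  also have "\<dots> = ennreal (k powr Q) * ?I w"
    by (intro nn_integral_cmult) measurable
  finally have "ennpowr (?I (\<lambda>t. ennreal k * w t)) (1 / Q) = ennreal k * ennpowr (?I w) (1 / Q)"
    using Q k by (simp add: ennpowr_cmult powr_powr)
  then show ?thesis
    using False by (simp add: weighted_Lq_norm_def Q_def)
qed

text \<open>
  The measure \<open>dt/t\<close> is invariant under dilations, so only the weight contributes a factor.
\<close>

lemma weighted_Lq_norm_scale: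
  assumes [measurable]: "w \<in> borel_measurable borel" "A \<in> sets borel"
    and A: "A \<subseteq> {0<..}" and l: "0 < l" and q: "0 < q"
  shows "weighted_Lq_norm s q A w
    = ennreal (l powr (- s)) * weighted_Lq_norm s q {t. l * t \<in> A} (\<lambda>t. w (l * t))"
proof (cases "q = \<infinity>")
  case True
  have "A = (\<lambda>t. l * t) ` {t. l * t \<in> A}"
    using l by (auto intro!: image_eqI[of _ _ "_ / l"])
  then have "weighted_Lq_norm s q A w = weighted_Lq_norm s q ((\<lambda>t. l * t) ` {t. l * t \<in> A}) w"
    by simp
  also have "\<dots> = (SUP t\<in>{t. l * t \<in> A}. ennreal ((l * t) powr (- s)) * w (l * t))"
    using True by (simp add: weighted_Lq_norm_def image_image)
  also have "\<dots> = (SUP t\<in>{t. l * t \<in> A}. ennreal (l powr (- s)) * (ennreal (t powr (- s)) * w (l * t)))"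
    using l by (simp add: powr_mult ennreal_mult mult.assoc)
  finally show ?thesis
    using True by (simp add: weighted_Lq_norm_def SUP_mult_left_ennreal)
next
  case False
  define Q where "Q = enn2real q"
  have Q: "0 < Q"
    using q False by (simp add: Q_def enn2real_pos)
  define B where "B = {t. l * t \<in> A}"
  have [measurable]: "B \<in> sets borel"
    unfolding B_def by measurable
  let ?g = "\<lambda>w A t. ennreal (t powr (- s * Q)) * ennpowr (w t) Q / ennreal t * indicator A t"
  \<comment> \<open>The Jacobian \<open>l\<close> cancels against the density \<open>1 / t\<close>.\<close>
  have pointwise: "ennreal l * ?g w A (l * t) = ennreal (l powr (- s * Q)) * ?g (\<lambda>t. w (l * t)) B t" for t
  proof (cases "l * t \<in> A")
    case True
    then have "0 < t"
      using A l by (auto simp: zero_less_mult_iff)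
    have "ennreal l * (X / ennreal (l * t)) = X / ennreal t" for X
      using l \<open>0 < t\<close> divide_mult_eq[of "ennreal l" X "ennreal t"]
      by (simp add: ennreal_mult ennreal_times_divide mult.commute)
    then show ?thesis
      using True l \<open>0 < t\<close> 
      by (simp add: B_def powr_mult ennreal_mult mult.left_commute[of "ennreal l"] mult.assoc
          flip: ennreal_times_divide)
  qed (simp add: B_def)
  have "(\<integral>\<^sup>+t. ?g w A t \<partial>lborel) = ennreal l * (\<integral>\<^sup>+t. ?g w A (l * t) \<partial>lborel)"
    using l by (subst nn_integral_real_affine[of _ l 0]) auto
  also have "\<dots> = (\<integral>\<^sup>+t. ennreal l * ?g w A (l * t) \<partial>lborel)"
    by (intro nn_integral_cmult[symmetric]) measurable
  also have "\<dots> = ennreal (l powr (- s * Q)) * (\<integral>\<^sup>+t. ?g (\<lambda>t. w (l * t)) B t \<partial>lborel)"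
    unfolding pointwise by (intro nn_integral_cmult) measurable
  finally have "ennpowr (\<integral>\<^sup>+t. ?g w A t \<partial>lborel) (1 / Q)
      = ennreal (l powr (- s)) * ennpowr (\<integral>\<^sup>+t. ?g (\<lambda>t. w (l * t)) B t \<partial>lborel) (1 / Q)"
    using Q by (simp add: ennpowr_cmult powr_powr)
  then show ?thesis
    using False by (simp add: weighted_Lq_norm_def Q_def B_def)
qed

lemma weighted_Lq_norm_Un_le:
  assumes [measurable]: "w \<in> borel_measurable borel" "A \<in> sets borel" "B \<in> sets borel"
    and disj: "A \<inter> B = {}" and q: "0 < q"
  shows "weighted_Lq_norm s q (A \<union> B) w
    \<le> ennreal (2 powr (1 / enn2real q)) * (weighted_Lq_norm s q A w + weighted_Lq_norm s q B w)"
proof (cases "q = \<infinity>")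
  case True
  then show ?thesis
    by (auto simp: weighted_Lq_norm_def SUP_union intro: add_increasing add_increasing2)
next
  case False
  then have "0 < enn2real q"
    using q by (simp add: enn2real_pos)
  then show ?thesis
    using False disj by (simp add: weighted_Lq_norm_def nn_integral_disjoint_pair ennpowr_add_le)
qed

lemma weighted_Lq_norm_atLeast_finite:
  assumes s: "0 < s" and q: "0 < q"
  shows "weighted_Lq_norm s q {1..} (\<lambda>_. 1) < \<infinity>"
proof (cases "q = \<infinity>")
  case True
  have "(SUP t\<in>{1..}. ennreal (t powr (- s))) \<le> 1"
    using s by (intro SUP_least) (auto intro!: powr_le1 simp: powr_minus inverse_le_1_iff ge_one_powr_ge_zero)
  then show ?thesis
    using True by (auto simp: weighted_Lq_norm_def intro: le_less_trans)
next
  case False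
  define Q where "Q = enn2real q"
  have Q: "0 < Q"
    using q False by (simp add: Q_def enn2real_pos)
  have "((\<lambda>t. t powr (- (s * Q))) \<longlongrightarrow> 0) at_top"
    using s Q by (intro tendsto_neg_powr filterlim_ident) auto
  then have lim: "((\<lambda>t. - (t powr (- s * Q) / (s * Q))) \<longlongrightarrow> 0) at_top"
    using tendsto_minus[OF tendsto_divide[OF _ tendsto_const, of _ 0 at_top "s * Q"]] s Q by simp
  have "(\<integral>\<^sup>+t\<in>{1..}. (ennreal (t powr (- s * Q)) * ennpowr 1 Q / ennreal t) \<partial>lborel)
      = (\<integral>\<^sup>+t. ennreal (t powr (- s * Q - 1)) * indicator {1..} t \<partial>lborel)"
    by (intro nn_integral_cong)
      (auto simp: ennpowr_def divide_ennreal powr_diff split: split_indicator)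
  also have "\<dots> = ennreal (0 - (- (1 powr (- s * Q) / (s * Q))))"
    using s Q
    by (intro nn_integral_FTC_atLeast[OF _ _ _ lim]) (auto intro!: derivative_eq_intros)
  finally show ?thesis
    using False by (simp add: weighted_Lq_norm_def Q_def ennpowr_def)
qed

lemma weighted_Lq_norm_dyadic_pos:
  assumes q: "0 < q"
  shows "0 < weighted_Lq_norm s q {2..<4} (\<lambda>_. 1)"
proof (cases "q = \<infinity>")
  case True
  have "0 < ennreal (2 powr (- s))"
    by simp
  also have "\<dots> \<le> (SUP t\<in>{2..<4}. ennreal (t powr (- s)))"
    by (intro SUP_upper) simp
  finally show ?thesis
    using True by (simp add: weighted_Lq_norm_def)
next
  case False
  define Q where "Q = enn2real q"
  have Q: "0 < Q"
    using q False by (simp add: Q_def enn2real_pos)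
  let ?g = "\<lambda>t::real. ennreal (t powr (- s * Q)) * ennpowr 1 Q / ennreal t * indicator {2..<4} t"
  have "\<not> (AE t in lborel. ?g t = 0)"
  proof
    assume "AE t in lborel. ?g t = 0"
    then have "AE t in lborel. t \<notin> {2..<4::real}"
      by (rule eventually_mono) (auto simp: ennpowr_def split: split_indicator_asm)
    then have "emeasure lborel {2..<4::real} = 0"
      by (subst (asm) AE_iff_measurable[of "{2..<4}"]) auto
    then show False
      by simp
  qed
  then have "(\<integral>\<^sup>+t. ?g t \<partial>lborel) \<noteq> 0"
    by (subst nn_integral_0_iff_AE) auto
  then show ?thesis
    using False by (auto simp: weighted_Lq_norm_def Q_def ennpowr_def enn2real_eq_0_iff zero_less_iff_neq_zero)
qed

section \<open>Dilation of Besov norms\<close>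

text \<open>
  Dilating \<open>f\<close> dilates its modulus of smoothness, up to the factor that the \<open>L\<^sub>p\<close> norm produces; rescaling
  \<open>t\<close> then turns the unit interval into \<open>(0,l)\<close>.
\<close>

lemma besov_norm_dilation:
  fixes f :: "'a::euclidean_space \<Rightarrow> complex"
  assumes f: "f \<in> borel_measurable lebesgue" and p: "0 < p" and q: "0 < q" and l: "0 < l"
  defines "e \<equiv> enn2real (of_nat DIM('a) / p)"
  shows "besov_norm r s p q (\<lambda>x. f (l *\<^sub>R x))
    = ennreal (l powr (- e)) * Lp_norm p f
      + ennreal (l powr (s - e)) * weighted_Lq_norm s q {0<..<l} (modulus_of_smoothness r p f)"
proof -
  let ?w = "modulus_of_smoothness r p f" and ?N = "weighted_Lq_norm s q"
  have w [measurable]: "?w \<in> borel_measurable borel"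
    by (intro borel_measurable_mono_ennreal mono_modulus_of_smoothness)
  have "{t. l * t \<in> {0<..<l}} = {0<..<1}"
    using l by (auto simp: zero_less_mult_iff)
  then have "?N {0<..<l} ?w = ennreal (l powr (- s)) * ?N {0<..<1} (\<lambda>t. ?w (l * t))"
    using weighted_Lq_norm_scale[OF w _ _ l q, of "{0<..<l}" s] by (simp add: greaterThanLessThan_def)
  then have "ennreal (l powr s) * ?N {0<..<l} ?w = ennreal (l powr s * l powr (- s)) * ?N {0<..<1} (\<lambda>t. ?w (l * t))"
    by (simp add: ennreal_mult mult.assoc)
  then have scale: "?N {0<..<1} (\<lambda>t. ?w (l * t)) = ennreal (l powr s) * ?N {0<..<l} ?w"
    using l by (simp flip: powr_add)
  have "?N {0<..<1} (modulus_of_smoothness r p (\<lambda>x. f (l *\<^sub>R x)))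
      = ?N {0<..<1} (\<lambda>t. ennreal (l powr (- e)) * ?w (l * t))"
    unfolding e_def by (intro arg_cong[where f = "?N _"] ext modulus_of_smoothness_scale f p l)
  also have "\<dots> = ennreal (l powr (- e)) * ?N {0<..<1} (\<lambda>t. ?w (l * t))"
    using q by (intro weighted_Lq_norm_cmult) auto
  also have "\<dots> = ennreal (l powr (- e) * l powr s) * ?N {0<..<l} ?w"
    by (simp add: scale ennreal_mult mult.assoc)
  also have "l powr (- e) * l powr s = l powr (s - e)"
    by (simp flip: powr_add)
  finally show ?thesis
    using Lp_norm_affine[OF f l p, of 0] by (simp add: besov_norm_eq e_def)
qed

text \<open>
  Rescaling moves the dependence on \<open>l\<close> into an explicit factor: the intervals \<open>[2l,4l)\<close> and
  \<open>[l,\<infinity>)\<close> used below become \<open>[2,4)\<close> and \<open>[1,\<infinity>)\<close>, whose norms are constants independent of \<open>l\<close>.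
\<close>

lemma weighted_Lq_norm_const:
  assumes "A \<in> sets borel" "A \<subseteq> {0<..}" "0 < l" "0 < q" "M < \<infinity>" 
  shows "weighted_Lq_norm s q A (\<lambda>_. M) = ennreal (l powr (- s)) * M * weighted_Lq_norm s q {t. l * t \<in> A} (\<lambda>_. 1)"
proof -
  obtain m where m: "M = ennreal m" "0 \<le> m"
    using assms(5) by (cases M) auto
  have [measurable]: "A \<in> sets borel"
    by fact
  have "{t. l * t \<in> A} \<in> sets borel"
    by measurable
  then show ?thesis
    using weighted_Lq_norm_scale[of "\<lambda>_. M" A l q s] weighted_Lq_norm_cmult[of "\<lambda>_. 1" "{t. l * t \<in> A}" m q s] assms m
    by (simp add: mult.assoc)
qed

text \<open>
  A Poincare type inequality: functions with small support are small in \<open>L\<^sub>p\<close> relative to their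
  Besov norm. If the interval \<open>[2l,4l)\<close> lies in \<open>(0,1)\<close>, it carries enough of the Besov norm,
  because the modulus of smoothness is at least the \<open>L\<^sub>p\<close> norm there; for larger \<open>l\<close> the factor
  \<open>l powr (- s)\<close> is at most \<open>4 powr s\<close>.
\<close>

lemma Lp_norm_le_besov_norm_small_support:
  fixes p q :: ennreal and s :: real
  assumes p: "0 < p" and q: "0 < q" and s: "0 < s"
  shows "\<exists>C\<ge>0. \<forall>l. \<forall>f::'a::euclidean_space \<Rightarrow> complex.
    0 < l \<and> l \<le> 1 \<and> f \<in> Lp_space p \<and> ess_support f \<subseteq> ball 0 l \<longrightarrow>
      ennreal (l powr (- s)) * Lp_norm p f \<le> ennreal C * besov_norm r s p q f"
proof -
  let ?N = "weighted_Lq_norm s q"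
  have "?N {2..<4} (\<lambda>_. 1) \<le> ?N {1..} (\<lambda>_. 1)"
    by (rule weighted_Lq_norm_mono) auto
  then have "?N {2..<4} (\<lambda>_. 1) < \<infinity>"
    using weighted_Lq_norm_atLeast_finite[OF s q] by (rule le_less_trans)
  then obtain D where D: "?N {2..<4} (\<lambda>_. 1) = ennreal D" "0 < D"
    using weighted_Lq_norm_dyadic_pos[OF q, of s] by (cases "?N {2..<4} (\<lambda>_. 1)") auto
  have "ennreal (l powr (- s)) * Lp_norm p f \<le> ennreal (4 powr s + 1 / D) * besov_norm r s p q f"
    if l: "0 < l" "l \<le> 1" and f: "f \<in> Lp_space p" and supp: "ess_support f \<subseteq> ball 0 l"
    for l and f :: "'a \<Rightarrow> complex"
  proof (cases "l \<le> 1 / 4")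
    case True
    have "?N {2 * l..<4 * l} (\<lambda>_. Lp_norm p f) \<le> ?N {0<..<1} (modulus_of_smoothness r p f)"
      using f l True AE_zero_outside_ess_support[OF supp]
      by (intro weighted_Lq_norm_mono Lp_norm_le_modulus_of_smoothness) (auto simp: Lp_space_def)
    also have "?N {2 * l..<4 * l} (\<lambda>_. Lp_norm p f)
        = ennreal (l powr (- s)) * Lp_norm p f * ?N {t. l * t \<in> {2 * l..<4 * l}} (\<lambda>_. 1)"
      using l f q by (intro weighted_Lq_norm_const) (auto simp: Lp_space_def)
    also have "{t. l * t \<in> {2 * l..<4 * l}} = {2..<4}"
      using l by (auto simp: mult.commute)
    finally have *: "ennreal (l powr (- s)) * Lp_norm p f * ennreal D \<le> besov_norm r s p q f"
      by (simp add: D besov_norm_eq add_increasing)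
    have "ennreal (l powr (- s)) * Lp_norm p f = ennreal (l powr (- s)) * Lp_norm p f * ennreal (D * (1 / D))"
      using D by simp
    also have "\<dots> = ennreal (1 / D) * (ennreal (l powr (- s)) * Lp_norm p f * ennreal D)"
      using D by (subst ennreal_mult) (auto simp: mult_ac)
    also have "\<dots> \<le> ennreal (4 powr s + 1 / D) * besov_norm r s p q f"
      using D by (intro mult_mono * ennreal_leI) auto
    finally show ?thesis .
  next
    case False
    have "l powr (- s) \<le> (1 / 4) powr (- s)"
      using False s l by (intro powr_mono2') auto
    also have "\<dots> = 4 powr s"
      by (simp add: powr_minus powr_divide)
    also have "\<dots> \<le> 4 powr s + 1 / D"
      using D by simp
    finally show ?thesis
      by (intro mult_mono ennreal_leI) (auto simp: besov_norm_eq)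
  qed
  then show ?thesis
    using D by (intro exI[of _ "4 powr s + 1 / D"]) auto
qed

text \<open>
  The modulus is bounded by a multiple of the \<open>L\<^sub>p\<close> norm, and the weight is integrable at infinity;
  the power of \<open>l\<close> is the value of the weighted norm of a constant on \<open>[l,\<infinity>)\<close>, up to a factor.
\<close>

lemma weighted_Lq_norm_modulus_tail_le:
  fixes p q :: ennreal and s :: real
  assumes p: "0 < p" and q: "0 < q" and s: "0 < s"
  shows "\<exists>C\<ge>0. \<forall>l. \<forall>f::'a::euclidean_space \<Rightarrow> complex. 0 < l \<and> f \<in> Lp_space p \<longrightarrow>
    weighted_Lq_norm s q {l..<1} (modulus_of_smoothness r p f)
      \<le> ennreal C * (ennreal (l powr (- s)) * Lp_norm p f)"
proof -
  let ?N = "weighted_Lq_norm s q"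
  obtain T where T: "?N {1..} (\<lambda>_. 1) = ennreal T" "0 \<le> T"
    using weighted_Lq_norm_atLeast_finite[OF s q] by (cases "?N {1..} (\<lambda>_. 1)") auto
  define K where "K = (4 * 2 powr (1 / enn2real p)) ^ r"
  have "?N {l..<1} (modulus_of_smoothness r p f) \<le> ennreal (K * T) * (ennreal (l powr (- s)) * Lp_norm p f)"
    if l: "0 < l" and f: "f \<in> Lp_space p" for l and f :: "'a \<Rightarrow> complex"
  proof -
    have "?N {l..<1} (modulus_of_smoothness r p f) \<le> ?N {l..} (\<lambda>_. ennreal K * Lp_norm p f)"
      using f p unfolding K_def
      by (intro weighted_Lq_norm_mono modulus_of_smoothness_le) (auto simp: Lp_space_def)
    also have "\<dots> = ennreal (l powr (- s)) * (ennreal K * Lp_norm p f) * ?N {t. l * t \<in> {l..}} (\<lambda>_. 1)"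
      using l f q by (intro weighted_Lq_norm_const) (auto simp: Lp_space_def ennreal_mult_less_top)
    also have "{t. l * t \<in> {l..}} = {1..}"
      using l by auto
    finally show ?thesis
      using T by (simp add: K_def ennreal_mult mult_ac)
  qed
  then show ?thesis
    using T by (intro exI[of _ "K * T"]) (auto simp: K_def)
qed

theorem theorem2p2:
  fixes p q :: ennreal and s :: real and r :: nat
  assumes "0 < p" and "0 < q" and "0 < s" and "s < real r"
  shows "\<exists>c1>0. \<exists>c2>0. \<forall>l::real. \<forall>f::'a::euclidean_space \<Rightarrow> complex.
    0 < l \<and> l \<le> 1 \<and> f \<in> besov_space r s p q \<and> ess_support f \<subseteq> ball 0 l \<longrightarrow>
      ennreal (c1 * l powr (s - enn2real (of_nat DIM('a) / p))) * besov_norm r s p q f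
        \<le> besov_norm r s p q (\<lambda>x. f (l *\<^sub>R x)) \<and>
      besov_norm r s p q (\<lambda>x. f (l *\<^sub>R x))
        \<le> ennreal (c2 * l powr (s - enn2real (of_nat DIM('a) / p))) * besov_norm r s p q f"
proof -
  let ?N = "weighted_Lq_norm s q" and ?B = "besov_norm r s p q"
  define e where "e = enn2real (of_nat DIM('a) / p)"
  obtain C where C: "0 \<le> C" and le_besov: "\<And>l f::'a \<Rightarrow> complex.
      0 < l \<Longrightarrow> l \<le> 1 \<Longrightarrow> f \<in> Lp_space p \<Longrightarrow> ess_support f \<subseteq> ball 0 l \<Longrightarrow>
      ennreal (l powr (- s)) * Lp_norm p f \<le> ennreal C * ?B f"
    using Lp_norm_le_besov_norm_small_support[OF assms(1-3), where 'a = 'a, of r] by blast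
  obtain C' where C': "0 \<le> C'" and tail: "\<And>l f::'a \<Rightarrow> complex. 0 < l \<Longrightarrow> f \<in> Lp_space p \<Longrightarrow>
      ?N {l..<1} (modulus_of_smoothness r p f) \<le> ennreal C' * (ennreal (l powr (- s)) * Lp_norm p f)"
    using weighted_Lq_norm_modulus_tail_le[OF assms(1-3), where 'a = 'a, of r] by blast
  define K where "K = 2 powr (1 / enn2real q)"
  have K: "0 < K"
    by (simp add: K_def)
  define c where "c = 1 + K * (1 + C')"
  have c: "0 < c"
    using K C' by (auto simp: c_def intro!: add_pos_nonneg)
  have "ennreal (1 / c * l powr (s - e)) * ?B f \<le> ?B (\<lambda>x. f (l *\<^sub>R x)) \<and>
      ?B (\<lambda>x. f (l *\<^sub>R x)) \<le> ennreal ((C + 1) * l powr (s - e)) * ?B f"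
    if l: "0 < l" "l \<le> 1" and f: "f \<in> besov_space r s p q" and supp: "ess_support f \<subseteq> ball 0 l"
    for l and f :: "'a \<Rightarrow> complex"
  proof -
    have Lp: "f \<in> Lp_space p" and meas: "f \<in> borel_measurable lebesgue"
      using f by (auto simp: besov_space_def Lp_space_def)
    let ?w = "modulus_of_smoothness r p f" and ?F = "Lp_norm p f"
    let ?k = "ennreal (l powr (s - e))" and ?G = "?B (\<lambda>x. f (l *\<^sub>R x))"
    have G: "?G = ennreal (l powr (- e)) * ?F + ?k * ?N {0<..<l} ?w"
      using besov_norm_dilation[OF meas assms(1,2) l(1)] by (simp add: e_def)
    have k: "ennreal (l powr (- e)) = ?k * ennreal (l powr (- s))"
      by (simp flip: ennreal_mult powr_add)
    have "?G \<le> ?k * (ennreal C * ?B f) + ?k * ?B f"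
      unfolding G k mult.assoc
      using l le_besov[OF l Lp supp]
      by (intro add_mono mult_left_mono)
        (auto simp: besov_norm_eq intro!: add_increasing weighted_Lq_norm_mono)
    also have "\<dots> = ennreal ((C + 1) * l powr (s - e)) * ?B f"
      using C by (simp add: ennreal_mult algebra_simps)
    finally have upper: "?G \<le> ennreal ((C + 1) * l powr (s - e)) * ?B f" .

    have "1 \<le> l powr (- s)"
      using l assms(3) by (simp add: powr_minus one_le_inverse powr_le1)
    then have "?k * ?F \<le> ?k * (ennreal (l powr (- s)) * ?F)"
      using mult_right_mono[of 1 "ennreal (l powr (- s))" ?F] by (intro mult_left_mono) auto
    also have "\<dots> \<le> ?G"
      by (simp add: G k mult.assoc)
    finally have F: "?k * ?F \<le> ?G" .

    have "?N {0<..<1} ?w = ?N ({0<..<l} \<union> {l..<1}) ?w"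
      using l by (intro arg_cong[where f = "\<lambda>A. ?N A ?w"]) auto
    also have "\<dots> \<le> ennreal K * (?N {0<..<l} ?w + ?N {l..<1} ?w)"
      unfolding K_def using assms(2)
      by (intro weighted_Lq_norm_Un_le borel_measurable_mono_ennreal mono_modulus_of_smoothness) auto
    also have "\<dots> \<le> ennreal K * (?N {0<..<l} ?w + ennreal C' * (ennreal (l powr (- s)) * ?F))"
      by (intro mult_left_mono add_left_mono tail l Lp) auto
    finally have "?k * ?N {0<..<1} ?w
        \<le> ?k * (ennreal K * (?N {0<..<l} ?w + ennreal C' * (ennreal (l powr (- s)) * ?F)))"
      by (rule mult_left_mono) simp
    also have "\<dots> = ennreal K * (?k * ?N {0<..<l} ?w + ennreal C' * (ennreal (l powr (- e)) * ?F))"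
      unfolding k by (simp add: distrib_left mult_ac)
    also have "\<dots> \<le> ennreal K * (?G + ennreal C' * ?G)"
      unfolding G by (intro mult_left_mono add_mono) (auto intro: add_increasing add_increasing2)
    finally have "?k * ?B f \<le> ?G + ennreal K * (?G + ennreal C' * ?G)"
      using F by (simp add: besov_norm_eq distrib_left add_mono)
    also have "\<dots> = ennreal c * ?G"
      using K C' by (simp add: c_def ennreal_mult algebra_simps)
    finally have "ennreal (1 / c) * (?k * ?B f) \<le> ennreal (1 / c) * (ennreal c * ?G)"
      by (rule mult_left_mono) simp
    also have "\<dots> = ?G"
      using c by (simp flip: mult.assoc ennreal_mult)
    finally have "ennreal (1 / c * l powr (s - e)) * ?B f \<le> ?G"
      using c by (subst ennreal_mult) (auto simp: mult.assoc)
    with upper show ?thesis by simp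
  qed
  then show ?thesis
    using C c unfolding e_def[symmetric]
    by (intro exI[of _ "1 / c"] exI[of _ "C + 1"] conjI) auto
qed

end
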